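(* Let $\mathfrak{F}$ be a saturated formation of finite groups and let $G$ be a finite group. If $G$ has no non-trivial normal $\mathfrak{F}$-central subgroups, then $C_G(G^{\mathfrak{F}})\leq G^{\mathfrak{F}}$.
   Context: All groups are finite. For a class of groups $\mathfrak{F}$ and a group $G$, the $\mathfrak{F}$-residual $G^{\mathfrak{F}}$ is the intersection of all normal subgroups $N$ of $G$ with $G/N\in\mathfrak{F}$. A non-empty class of groups $\mathfrak{F}$ (closed under isomorphism) is a formation if every homomorphic image of $G/G^{\mathfrak{F}}$ belongs to $\mathfrak{F}$ for every group $G$. A formation $\mathfrak{F}$ is saturated if $G\in\mathfrak{F}$ whenever $G^{\mathfrak{F}}\leq\Phi(G)$ (the Frattini subgroup). Let $R/S$ be a normal section of $G$ (that is, $S\leq R$ and $S,R\trianglelefteq G$). The centraliser $C_G(R/S)$ is the set of $g\in G$ with $g^{-1}rgS=rS$ for all $r\in R$. If $K\trianglelefteq G$ and $K\leq C_G(R/S)$, then $[R/S](G/K)$ denotes the semidirect product of $R/S$ with $G/K$ acting by $(rS)^{gK}=g^{-1}rgS$. The section $R/S$ is $\mathfrak{F}$-central in $G$ if $[R/S](G/K)\in\mathfrak{F}$ for some normal subgroup $K$ of $G$ with $K\leq C_G(R/S)$. A normal subgroup $R$ of $G$ is $\mathfrak{F}$-central in $G$ if the section $R/1$ is $\mathfrak{F}$-central in $G$. *)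

theory Defs
  imports "HOL-Algebra.Algebra"
begin

text \<open>
  HOL cannot quantify over all carrier types, but every finite group is isomorphic to a group
  whose elements are natural numbers.  An isomorphism-closed class of finite groups is therefore
  given by its members of type \<^typ>\<open>nat monoid\<close>; a finite group over an arbitrary type belongs to
  the class iff it is isomorphic to one of these members.
\<close>

definition group_class :: "nat monoid set \<Rightarrow> bool" where
  "group_class F \<longleftrightarrow>
     (\<forall>H\<in>F. group H \<and> finite (carrier H)) \<and>
     (\<forall>H\<in>F. \<forall>K :: nat monoid. group K \<and> H \<cong> K \<longrightarrow> K \<in> F)"

definition in_class :: "('a, 'b) monoid_scheme \<Rightarrow> nat monoid set \<Rightarrow> bool" where
  "in_class G F \<longleftrightarrow> group G \<and> (\<exists>H\<in>F. G \<cong> H)"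

text \<open>
  The intersection of the empty family is taken to be the whole group, both for the residual and
  for the Frattini subgroup.
\<close>

definition residual :: "nat monoid set \<Rightarrow> ('a, 'b) monoid_scheme \<Rightarrow> 'a set" where
  "residual F G = carrier G \<inter> \<Inter>{N. N \<lhd> G \<and> in_class (G Mod N) F}"

definition formation :: "nat monoid set \<Rightarrow> bool" where
  "formation F \<longleftrightarrow>
     group_class F \<and> F \<noteq> {} \<and>
     (\<forall>G :: nat monoid. group G \<and> finite (carrier G) \<longrightarrow>
        (\<forall>H :: nat monoid. group H \<and> epi (G Mod residual F G) H \<noteq> {} \<longrightarrow> H \<in> F))"

definition maximal_subgroup :: "'a set \<Rightarrow> ('a, 'b) monoid_scheme \<Rightarrow> bool" where
  "maximal_subgroup M G \<longleftrightarrow>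
     subgroup M G \<and> M \<noteq> carrier G \<and>
     (\<forall>H. subgroup H G \<and> M \<subseteq> H \<longrightarrow> H = M \<or> H = carrier G)"

definition frattini :: "('a, 'b) monoid_scheme \<Rightarrow> 'a set" where
  "frattini G = carrier G \<inter> \<Inter>{M. maximal_subgroup M G}"

definition saturated_formation :: "nat monoid set \<Rightarrow> bool" where
  "saturated_formation F \<longleftrightarrow>
     formation F \<and>
     (\<forall>G :: nat monoid. group G \<and> finite (carrier G) \<and> residual F G \<subseteq> frattini G \<longrightarrow> G \<in> F)"

definition normal_section :: "'a set \<Rightarrow> 'a set \<Rightarrow> ('a, 'b) monoid_scheme \<Rightarrow> bool" where
  "normal_section R S G \<longleftrightarrow> R \<lhd> G \<and> S \<lhd> G \<and> S \<subseteq> R"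

definition section_group ::
    "('a, 'b) monoid_scheme \<Rightarrow> 'a set \<Rightarrow> 'a set \<Rightarrow> 'a set monoid" where
  "section_group G R S = (G\<lparr>carrier := R\<rparr>) Mod S"

definition section_centraliser ::
    "('a, 'b) monoid_scheme \<Rightarrow> 'a set \<Rightarrow> 'a set \<Rightarrow> 'a set" where
  "section_centraliser G R S =
     {g \<in> carrier G. \<forall>r\<in>R. (inv\<^bsub>G\<^esub> g \<otimes>\<^bsub>G\<^esub> r \<otimes>\<^bsub>G\<^esub> g) <#\<^bsub>G\<^esub> S = r <#\<^bsub>G\<^esub> S}"

definition set_centraliser :: "('a, 'b) monoid_scheme \<Rightarrow> 'a set \<Rightarrow> 'a set" where
  "set_centraliser G A = {g \<in> carrier G. \<forall>a\<in>A. g \<otimes>\<^bsub>G\<^esub> a = a \<otimes>\<^bsub>G\<^esub> g}"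

text \<open>
  For a right action \<open>act n h = n\<^sup>h\<close> of \<open>H\<close> on \<open>N\<close>, the pair \<open>(n, h)\<close> stands for the
  product \<open>h n\<close> in the semidirect product, so that \<open>(h\<^sub>1 n\<^sub>1) (h\<^sub>2 n\<^sub>2) = (h\<^sub>1 h\<^sub>2) (n\<^sub>1\<^sup>h\<^sup>2 n\<^sub>2)\<close>.
\<close>

definition semidirect ::
    "('n, 'c) monoid_scheme \<Rightarrow> ('h, 'd) monoid_scheme \<Rightarrow> ('n \<Rightarrow> 'h \<Rightarrow> 'n) \<Rightarrow> ('n \<times> 'h) monoid" where
  "semidirect N H act =
     \<lparr>carrier = carrier N \<times> carrier H,
      monoid.mult = (\<lambda>(n1, h1) (n2, h2). (act n1 h2 \<otimes>\<^bsub>N\<^esub> n2, h1 \<otimes>\<^bsub>H\<^esub> h2)),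
      one = (\<one>\<^bsub>N\<^esub>, \<one>\<^bsub>H\<^esub>)\<rparr>"

text \<open>
  Conjugation of a coset \<open>A = rS\<close> by a coset \<open>B = gK\<close>, written without choosing representatives;
  lemma \<open>coset_conj_eq\<close> below gives its value \<open>g\<^sup>-\<^sup>1 r g S\<close>.
\<close>

definition coset_conj :: "('a, 'b) monoid_scheme \<Rightarrow> 'a set \<Rightarrow> 'a set \<Rightarrow> 'a set" where
  "coset_conj G A B = (\<Union>g\<in>B. (\<lambda>x. inv\<^bsub>G\<^esub> g \<otimes>\<^bsub>G\<^esub> x \<otimes>\<^bsub>G\<^esub> g) ` A)"

definition section_semidirect ::
    "('a, 'b) monoid_scheme \<Rightarrow> 'a set \<Rightarrow> 'a set \<Rightarrow> 'a set \<Rightarrow> ('a set \<times> 'a set) monoid" where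
  "section_semidirect G R S K = semidirect (section_group G R S) (G Mod K) (coset_conj G)"

definition central_section ::
    "nat monoid set \<Rightarrow> ('a, 'b) monoid_scheme \<Rightarrow> 'a set \<Rightarrow> 'a set \<Rightarrow> bool" where
  "central_section F G R S \<longleftrightarrow>
     normal_section R S G \<and>
     (\<exists>K. K \<lhd> G \<and> K \<subseteq> section_centraliser G R S \<and> in_class (section_semidirect G R S K) F)"

definition central_normal_subgroup ::
    "nat monoid set \<Rightarrow> ('a, 'b) monoid_scheme \<Rightarrow> 'a set \<Rightarrow> bool" where
  "central_normal_subgroup F G R \<longleftrightarrow> R \<lhd> G \<and> central_section F G R {\<one>\<^bsub>G\<^esub>}"

lemma in_class_nat_iff:
  fixes G :: "nat monoid"
  assumes "group_class F"
  shows "in_class G F \<longleftrightarrow> G \<in> F"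
  using assms unfolding group_class_def in_class_def
  by (metis group.iso_sym iso_refl)

lemma finite_group_nat_copy:
  assumes G: "group G" and fin: "finite (carrier G)"
  shows "\<exists>H :: nat monoid. group H \<and> finite (carrier H) \<and> G \<cong> H"
proof -
  interpret group G by fact
  obtain f :: "_ \<Rightarrow> nat" where f: "inj_on f (carrier G)"
    using fin by (meson finite_imp_inj_to_nat_seg)
  define g where "g = the_inv_into (carrier G) f"
  define H where "H = \<lparr>carrier = f ` carrier G, monoid.mult = (\<lambda>x y. f (g x \<otimes>\<^bsub>G\<^esub> g y)), one = f \<one>\<^bsub>G\<^esub>\<rparr>"
  have gf: "g (f x) = x" if "x \<in> carrier G" for x
    using that f by (simp add: g_def the_inv_into_f_f)
  have "group H"
    unfolding H_def
    by (rule groupI) (auto simp: gf m_assoc intro!: bexI[of _ "inv\<^bsub>G\<^esub> _"])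
  moreover have "f \<in> iso G H"
    using f by (auto simp: iso_def hom_def H_def gf bij_betw_def)
  ultimately show ?thesis
    using fin by (auto simp: is_iso_def H_def)
qed

lemma coset_conj_eq:
  assumes sec: "normal_section R S G" and K: "K \<lhd> G" "K \<subseteq> section_centraliser G R S"
    and r: "r \<in> R" and g: "g \<in> carrier G"
  shows "coset_conj G (r <#\<^bsub>G\<^esub> S) (g <#\<^bsub>G\<^esub> K) = (inv\<^bsub>G\<^esub> g \<otimes>\<^bsub>G\<^esub> r \<otimes>\<^bsub>G\<^esub> g) <#\<^bsub>G\<^esub> S"
proof -
  have R: "R \<lhd> G" and S: "S \<lhd> G" using sec by (auto simp: normal_section_def)
  interpret G: group G using R by (rule normal.axioms)
  interpret R: normal R G by fact
  interpret S: normal S G by fact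
  interpret K: normal K G by fact
  let ?r = "inv\<^bsub>G\<^esub> g \<otimes>\<^bsub>G\<^esub> r \<otimes>\<^bsub>G\<^esub> g"
  have rc: "r \<in> carrier G" using r R.subset by auto
  have r': "?r \<in> R" using g r by (simp add: R.inv_op_closed1)
  have r'c: "?r \<in> carrier G" using g rc by simp
  show ?thesis
  proof (intro equalityI subsetI)
    fix y assume "y \<in> coset_conj G (r <#\<^bsub>G\<^esub> S) (g <#\<^bsub>G\<^esub> K)"
    then obtain s k where s: "s \<in> S" and k: "k \<in> K"
      and y: "y = inv\<^bsub>G\<^esub> (g \<otimes>\<^bsub>G\<^esub> k) \<otimes>\<^bsub>G\<^esub> (r \<otimes>\<^bsub>G\<^esub> s) \<otimes>\<^bsub>G\<^esub> (g \<otimes>\<^bsub>G\<^esub> k)"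
      by (auto simp: coset_conj_def l_coset_def)
    have sc: "s \<in> carrier G" and kc: "k \<in> carrier G" using s k S.subset K.subset by auto
    define s' where "s' = inv\<^bsub>G\<^esub> k \<otimes>\<^bsub>G\<^esub> (inv\<^bsub>G\<^esub> g \<otimes>\<^bsub>G\<^esub> s \<otimes>\<^bsub>G\<^esub> g) \<otimes>\<^bsub>G\<^esub> k"
    have s': "s' \<in> S" unfolding s'_def using s g kc by (simp add: S.inv_op_closed1)
    have s'c: "s' \<in> carrier G" using s' S.subset by auto
    let ?q = "inv\<^bsub>G\<^esub> k \<otimes>\<^bsub>G\<^esub> ?r \<otimes>\<^bsub>G\<^esub> k"
    have canc: "a \<otimes>\<^bsub>G\<^esub> (inv\<^bsub>G\<^esub> a \<otimes>\<^bsub>G\<^esub> b) = b" if "a \<in> carrier G" "b \<in> carrier G" for a b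
      using that by (simp flip: G.m_assoc)
    have "y = ?q \<otimes>\<^bsub>G\<^esub> s'"
      unfolding y s'_def using sc kc g rc by (simp add: G.inv_mult_group G.m_assoc canc)
    then have "y \<in> ?q <#\<^bsub>G\<^esub> S" using s' by (auto simp: l_coset_def)
    also have "?q <#\<^bsub>G\<^esub> S = ?r <#\<^bsub>G\<^esub> S"
      using K(2) k r' by (auto simp: section_centraliser_def)
    finally show "y \<in> ?r <#\<^bsub>G\<^esub> S" .
  next
    fix y assume "y \<in> ?r <#\<^bsub>G\<^esub> S"
    then obtain s where s: "s \<in> S" and y: "y = ?r \<otimes>\<^bsub>G\<^esub> s" by (auto simp: l_coset_def)
    have sc: "s \<in> carrier G" using s S.subset by auto
    let ?s = "g \<otimes>\<^bsub>G\<^esub> s \<otimes>\<^bsub>G\<^esub> inv\<^bsub>G\<^esub> g"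
    have "?s \<in> S" using g s by (simp add: S.inv_op_closed2)
    then have "r \<otimes>\<^bsub>G\<^esub> ?s \<in> r <#\<^bsub>G\<^esub> S" by (auto simp: l_coset_def)
    moreover have "g \<in> g <#\<^bsub>G\<^esub> K"
      using g K.one_closed by (force simp: l_coset_def)
    moreover have "y = inv\<^bsub>G\<^esub> g \<otimes>\<^bsub>G\<^esub> (r \<otimes>\<^bsub>G\<^esub> ?s) \<otimes>\<^bsub>G\<^esub> g"
      unfolding y using g sc rc by (simp add: G.m_assoc)
    ultimately show "y \<in> coset_conj G (r <#\<^bsub>G\<^esub> S) (g <#\<^bsub>G\<^esub> K)"
      unfolding coset_conj_def by blast
  qed
qed

lemma semidirect_group:
  assumes N: "group N" and H: "group H"
    and act: "\<And>h. h \<in> carrier H \<Longrightarrow> (\<lambda>n. act n h) \<in> hom N N"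
    and act_one: "\<And>n. n \<in> carrier N \<Longrightarrow> act n \<one>\<^bsub>H\<^esub> = n"
    and act_mult: "\<And>n h k. \<lbrakk>n \<in> carrier N; h \<in> carrier H; k \<in> carrier H\<rbrakk>
                    \<Longrightarrow> act n (h \<otimes>\<^bsub>H\<^esub> k) = act (act n h) k"
  shows "group (semidirect N H act)"
proof -
  interpret N: group N by fact
  interpret H: group H by fact
  have cl: "act n h \<in> carrier N" if "n \<in> carrier N" "h \<in> carrier H" for n h
    using act[OF that(2)] that(1) by (auto simp: hom_def)
  have am: "act (n \<otimes>\<^bsub>N\<^esub> m) h = act n h \<otimes>\<^bsub>N\<^esub> act m h"
    if "n \<in> carrier N" "m \<in> carrier N" "h \<in> carrier H" for n m h
    using act[OF that(3)] that(1,2) by (auto simp: hom_def)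
  have ao: "act \<one>\<^bsub>N\<^esub> h = \<one>\<^bsub>N\<^esub>" if "h \<in> carrier H" for h
    using hom_one[OF act[OF that] N N] .
  have inv: "\<exists>m\<in>carrier N. act m h \<otimes>\<^bsub>N\<^esub> n = \<one>\<^bsub>N\<^esub>"
    if "n \<in> carrier N" "h \<in> carrier H" for n h
    using that
    by (intro bexI[of _ "act (inv\<^bsub>N\<^esub> n) (inv\<^bsub>H\<^esub> h)"]) (auto simp: cl act_one simp flip: act_mult)
  show ?thesis
    unfolding semidirect_def
    by (rule groupI) (auto simp: cl am ao act_one act_mult N.m_assoc H.m_assoc inv H.l_inv_ex)
qed

lemma section_semidirect_group:
  assumes sec: "normal_section R S G" and K: "K \<lhd> G" "K \<subseteq> section_centraliser G R S"
  shows "group (section_semidirect G R S K)"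
proof -
  have R: "R \<lhd> G" and S: "S \<lhd> G" and SR: "S \<subseteq> R" using sec by (auto simp: normal_section_def)
  interpret G: group G using R by (rule normal.axioms)
  interpret R: normal R G by fact
  interpret S: normal S G by fact
  interpret K: normal K G by fact
  let ?N = "section_group G R S"
  have Rc: "r \<in> carrier G" if "r \<in> R" for r using that R.subset by auto
  have "S \<lhd> G\<lparr>carrier := R\<rparr>"
    using G.normal_restrict_supergroup[OF R.is_subgroup S SR] .
  then have N: "group ?N" unfolding section_group_def by (rule normal.factorgroup_is_group)
  have H: "group (G Mod K)" by (rule K.factorgroup_is_group)
  have carN: "carrier ?N = (\<lambda>r. r <#\<^bsub>G\<^esub> S) ` R"
  proof -
    have "carrier ?N = (\<lambda>r. S #>\<^bsub>G\<^esub> r) ` R"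
      by (auto simp: section_group_def carrier_FactGroup r_coset_def)
    also have "\<dots> = (\<lambda>r. r <#\<^bsub>G\<^esub> S) ` R"
      using S.coset_eq Rc by (auto intro!: image_cong)
    finally show ?thesis .
  qed
  have carH: "carrier (G Mod K) = (\<lambda>g. g <#\<^bsub>G\<^esub> K) ` carrier G"
    using K.coset_eq by (auto simp: carrier_FactGroup intro!: image_cong)
  have multN: "(a <#\<^bsub>G\<^esub> S) \<otimes>\<^bsub>?N\<^esub> (b <#\<^bsub>G\<^esub> S) = (a \<otimes>\<^bsub>G\<^esub> b) <#\<^bsub>G\<^esub> S" if "a \<in> R" "b \<in> R" for a b
  proof -
    have "(a <#\<^bsub>G\<^esub> S) \<otimes>\<^bsub>?N\<^esub> (b <#\<^bsub>G\<^esub> S) = (S #>\<^bsub>G\<^esub> a) <#>\<^bsub>G\<^esub> (S #>\<^bsub>G\<^esub> b)"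
      using that S.coset_eq Rc by (simp add: section_group_def set_mult_def)
    also have "\<dots> = (a \<otimes>\<^bsub>G\<^esub> b) <#\<^bsub>G\<^esub> S"
      using that S.coset_eq Rc S.rcos_sum[of a b] by simp
    finally show ?thesis .
  qed
  have multH: "(a <#\<^bsub>G\<^esub> K) \<otimes>\<^bsub>G Mod K\<^esub> (b <#\<^bsub>G\<^esub> K) = (a \<otimes>\<^bsub>G\<^esub> b) <#\<^bsub>G\<^esub> K"
    if "a \<in> carrier G" "b \<in> carrier G" for a b
  proof -
    have "(a <#\<^bsub>G\<^esub> K) \<otimes>\<^bsub>G Mod K\<^esub> (b <#\<^bsub>G\<^esub> K) = (K #>\<^bsub>G\<^esub> a) <#>\<^bsub>G\<^esub> (K #>\<^bsub>G\<^esub> b)"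
      using that K.coset_eq by simp
    also have "\<dots> = (a \<otimes>\<^bsub>G\<^esub> b) <#\<^bsub>G\<^esub> K"
      using that K.coset_eq K.rcos_sum[of a b] by simp
    finally show ?thesis .
  qed
  have oneH: "\<one>\<^bsub>G Mod K\<^esub> = \<one>\<^bsub>G\<^esub> <#\<^bsub>G\<^esub> K"
    using K.subset by (auto simp: l_coset_def)
  note conj = coset_conj_eq[OF sec K]
  have conj_closed: "inv\<^bsub>G\<^esub> g \<otimes>\<^bsub>G\<^esub> r \<otimes>\<^bsub>G\<^esub> g \<in> R" if "r \<in> R" "g \<in> carrier G" for r g
    using that by (simp add: R.inv_op_closed1)
  have canc: "a \<otimes>\<^bsub>G\<^esub> (inv\<^bsub>G\<^esub> a \<otimes>\<^bsub>G\<^esub> b) = b" if "a \<in> carrier G" "b \<in> carrier G" for a b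
    using that by (simp flip: G.m_assoc)
  show ?thesis
    unfolding section_semidirect_def
  proof (rule semidirect_group[OF N H])
    fix B assume "B \<in> carrier (G Mod K)"
    then obtain g where g: "g \<in> carrier G" "B = g <#\<^bsub>G\<^esub> K" unfolding carH by blast
    have "inv\<^bsub>G\<^esub> g \<otimes>\<^bsub>G\<^esub> (r \<otimes>\<^bsub>G\<^esub> t) \<otimes>\<^bsub>G\<^esub> g
        = (inv\<^bsub>G\<^esub> g \<otimes>\<^bsub>G\<^esub> r \<otimes>\<^bsub>G\<^esub> g) \<otimes>\<^bsub>G\<^esub> (inv\<^bsub>G\<^esub> g \<otimes>\<^bsub>G\<^esub> t \<otimes>\<^bsub>G\<^esub> g)" if "r \<in> R" "t \<in> R" for r t
      using that g Rc by (simp add: G.m_assoc canc)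
    then show "(\<lambda>n. coset_conj G n B) \<in> hom ?N ?N"
      using g by (auto simp: hom_def carN conj multN conj_closed R.m_closed)
  next
    fix A assume "A \<in> carrier ?N"
    then obtain r where r: "r \<in> R" "A = r <#\<^bsub>G\<^esub> S" unfolding carN by blast
    then show "coset_conj G A \<one>\<^bsub>G Mod K\<^esub> = A"
      unfolding oneH by (simp add: conj Rc)
  next
    fix A B C assume "A \<in> carrier ?N" "B \<in> carrier (G Mod K)" "C \<in> carrier (G Mod K)"
    then obtain r g h where "r \<in> R" "A = r <#\<^bsub>G\<^esub> S"
      "g \<in> carrier G" "B = g <#\<^bsub>G\<^esub> K" "h \<in> carrier G" "C = h <#\<^bsub>G\<^esub> K"
      unfolding carN carH by blast
    then show "coset_conj G A (B \<otimes>\<^bsub>G Mod K\<^esub> C) = coset_conj G (coset_conj G A B) C"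
      by (simp only: multH conj conj_closed G.m_closed)
         (simp add: G.inv_mult_group G.m_assoc Rc)
  qed
qed

end

theory Submission
  imports Defs
begin

text \<open>
  Write \<open>D\<close> for the \<open>F\<close>-residual of \<open>G\<close> and \<open>C\<close> for its centraliser; both are normal in \<open>G\<close>.  The proof
  produces an \<open>F\<close>-central normal subgroup \<open>R \<subseteq> C\<close> with \<open>C = (C \<inter> D) R\<close>.  By hypothesis \<open>R\<close> is
  trivial, and then \<open>C \<subseteq> D\<close>.

  Saturation enters only through supplements (\<open>supplement_in_class\<close>): if \<open>N\<close> is normal in a finite
  group \<open>X\<close> and \<open>X/N\<close> lies in \<open>F\<close>, then \<open>X = N Y\<close> for some subgroup \<open>Y\<close> in \<open>F\<close>.  Indeed, for a
  supplement \<open>Y\<close> of least order \<open>N \<inter> Y\<close> lies in the Frattini subgroup of \<open>Y\<close>, and \<open>Y/(N \<inter> Y)\<close> is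
  isomorphic to \<open>X/N\<close>.

  This is used twice.  First \<open>G = D L\<close> with \<open>L\<close> in \<open>F\<close>.  Put \<open>H = C L\<close>.  Then \<open>H/C\<close> is an image of
  \<open>L\<close>, and \<open>H/(H \<inter> D)\<close> is isomorphic to \<open>G/D\<close>, so both lie in \<open>F\<close> and the residual of \<open>H\<close> is
  contained in \<open>Z = C \<inter> D\<close>.  Hence \<open>H = Z Y\<close> with \<open>Y\<close> in \<open>F\<close>, and \<open>R\<close> is taken to be \<open>Y \<inter> C\<close>.
  It is normalised by \<open>Y\<close> and centralised by \<open>D\<close>, so it is normal in \<open>G = D H = D Y\<close>, and
  \<open>C = Z R\<close> by Dedekind's law because \<open>Z \<subseteq> C \<subseteq> H\<close>.

  It remains to see that \<open>R\<close> is \<open>F\<close>-central (\<open>central_normal_subgroup_if_in_supplement\<close>).  With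
  \<open>K\<close> the centraliser of \<open>R\<close> in \<open>G\<close>, which contains \<open>D\<close>, the equation \<open>G = K Y\<close> makes \<open>[R](G/K)\<close> an image of \<open>[R]Y\<close>.
  As \<open>R \<subseteq> Y\<close>, the group \<open>[R]Y\<close> is a subdirect subgroup of \<open>Y \<times> Y\<close>, and so it lies in \<open>F\<close>.
\<close>

section \<open>Formations of finite groups over arbitrary types\<close>

lemma in_class_iso:
  assumes "in_class G F" "G \<cong> H" "group H"
  shows "in_class H F"
proof -
  obtain K where K: "K \<in> F" "G \<cong> K" and G: "group G"
    using assms(1) by (auto simp: in_class_def)
  have "H \<cong> K"
    using iso_trans[OF group.iso_sym[OF G assms(2)] K(2)] .
  then show ?thesis
    using K(1) assms(3) by (auto simp: in_class_def)
qed

text \<open>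
  Images of quotients are obtained below by comparing kernels, so that no computation with cosets
  of cosets is needed.
\<close>

lemma epi_factor:
  assumes G: "group G" and H: "group H" and K: "group K"
    and f: "f \<in> epi G H" and g: "g \<in> epi G K" and ker: "kernel G H f \<subseteq> kernel G K g"
  shows "epi H K \<noteq> {}"
proof -
  interpret f: group_hom G H f
    using G H f by (auto simp: group_hom_def group_hom_axioms_def epi_def)
  interpret g: group_hom G K g
    using G K g by (auto simp: group_hom_def group_hom_axioms_def epi_def)
  have fsurj: "f ` carrier G = carrier H" and gsurj: "g ` carrier G = carrier K"
    using f g by (auto simp: epi_def)
  have eq: "g x = g y" if "x \<in> carrier G" "y \<in> carrier G" "f x = f y" for x y
  proof -
    have "x \<otimes>\<^bsub>G\<^esub> inv\<^bsub>G\<^esub> y \<in> kernel G H f" using that by (simp add: kernel_def)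
    then have "x \<otimes>\<^bsub>G\<^esub> inv\<^bsub>G\<^esub> y \<in> kernel G K g" using ker by blast
    then have *: "g x \<otimes>\<^bsub>K\<^esub> inv\<^bsub>K\<^esub> g y = \<one>\<^bsub>K\<^esub>" using that by (simp add: kernel_def)
    have "g x = (g x \<otimes>\<^bsub>K\<^esub> inv\<^bsub>K\<^esub> g y) \<otimes>\<^bsub>K\<^esub> g y" using that by (simp add: g.H.m_assoc)
    then show ?thesis using * that by simp
  qed
  obtain h where h: "\<And>x. x \<in> carrier G \<Longrightarrow> g x = h (f x)"
    using function_factors_left_gen[of "\<lambda>x. x \<in> carrier G" f g] eq by metis
  have "h \<in> hom H K"
  proof (rule homI)
    fix u v assume "u \<in> carrier H" "v \<in> carrier H"
    then obtain x y where "x \<in> carrier G" "u = f x" "y \<in> carrier G" "v = f y"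
      unfolding fsurj[symmetric] by blast
    then show "h u \<in> carrier K" "h (u \<otimes>\<^bsub>H\<^esub> v) = h u \<otimes>\<^bsub>K\<^esub> h v"
      by (simp_all flip: h f.hom_mult)
  qed
  moreover have "h ` carrier H = carrier K"
    unfolding fsurj[symmetric] gsurj[symmetric] by (simp add: image_image h)
  ultimately have "h \<in> epi H K" by (simp add: epi_def)
  then show ?thesis by blast
qed

text \<open>
  This lemma and \<open>in_class_if_residual_subset_kernel\<close> below say together that a quotient of \<open>G\<close> lies
  in \<open>F\<close> exactly if its kernel contains the residual; the later proofs use the axioms of a
  formation only through them.
\<close>

lemma residual_subset_kernel:
  assumes G: "group G" and f: "f \<in> epi G H" and H: "in_class H F"
  shows "residual F G \<subseteq> kernel G H f"
proof -
  interpret f: group_hom G H f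
    using G H f by (auto simp: group_hom_def group_hom_axioms_def epi_def in_class_def)
  have N: "kernel G H f \<lhd> G" by (rule f.normal_kernel)
  then have grp: "group (G Mod kernel G H f)" by (rule normal.factorgroup_is_group)
  have "G Mod kernel G H f \<cong> H"
    using f by (intro f.FactGroup_iso) (simp add: epi_def)
  then have "in_class (G Mod kernel G H f) F"
    using in_class_iso[OF H] group.iso_sym[OF grp] grp by blast
  then show ?thesis using N by (auto simp: residual_def)
qed

lemma normal_Inter:
  assumes G: "group G" and "\<And>N. N \<in> A \<Longrightarrow> N \<lhd> G"
  shows "carrier G \<inter> \<Inter>A \<lhd> G"
proof -
  interpret group G by fact
  have "subgroup (\<Inter>(insert (carrier G) A)) G"
  proof (rule subgroups_Inter)
    fix H assume "H \<in> insert (carrier G) A"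
    then show "subgroup H G" using subgroup_self normal_imp_subgroup[OF assms(2)] by blast
  qed blast
  then have sub: "subgroup (carrier G \<inter> \<Inter>A) G" by simp
  show ?thesis
  proof (rule normal_invI[OF sub])
    fix x h assume "x \<in> carrier G" "h \<in> carrier G \<inter> \<Inter>A"
    then show "x \<otimes>\<^bsub>G\<^esub> h \<otimes>\<^bsub>G\<^esub> inv\<^bsub>G\<^esub> x \<in> carrier G \<inter> \<Inter>A"
      using normal_invE(2)[OF assms(2)] by blast
  qed
qed

lemma normal_residual: "group G \<Longrightarrow> residual F G \<lhd> G"
  unfolding residual_def by (rule normal_Inter) auto

lemma kernel_r_coset:
  assumes "N \<lhd> G"
  shows "(\<lambda>x. N #>\<^bsub>G\<^esub> x) \<in> epi G (G Mod N)" "kernel G (G Mod N) (\<lambda>x. N #>\<^bsub>G\<^esub> x) = N"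
proof -
  interpret normal N G by fact
  show "(\<lambda>x. N #>\<^bsub>G\<^esub> x) \<in> epi G (G Mod N)"
    by (simp add: epi_def r_coset_hom_Mod carrier_FactGroup)
  show "kernel G (G Mod N) (\<lambda>x. N #>\<^bsub>G\<^esub> x) = N"
    using coset_join1[OF _ _ is_subgroup] coset_join2[OF _ is_subgroup]
    by (auto simp: kernel_def)
qed

text \<open>
  A quotient of \<open>H\<close> in \<open>F\<close> is also a quotient of \<open>G\<close> in \<open>F\<close>.  For isomorphisms this is what transports
  the residual between a group and its copies on the natural numbers.
\<close>

lemma residual_epi:
  assumes G: "group G" and H: "group H" and f: "f \<in> epi G H" and x: "x \<in> residual F G"
  shows "f x \<in> residual F H"
proof -
  have fc: "f x \<in> carrier H" using f x by (auto simp: epi_def residual_def)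
  moreover have "f x \<in> N" if N: "N \<lhd> H" "in_class (H Mod N) F" for N
  proof -
    have "(\<lambda>y. N #>\<^bsub>H\<^esub> y) \<circ> f \<in> epi G (H Mod N)"
      using f kernel_r_coset(1)[OF N(1)] by (rule epi_compose)
    then have "x \<in> kernel G (H Mod N) ((\<lambda>y. N #>\<^bsub>H\<^esub> y) \<circ> f)"
      using residual_subset_kernel[OF G _ N(2)] x by blast
    then show ?thesis
      using fc kernel_r_coset(2)[OF N(1)] by (auto simp: kernel_def)
  qed
  ultimately show ?thesis by (auto simp: residual_def)
qed

text \<open>
  The defining property of a formation speaks only about groups of natural numbers, so \<open>G\<close> and
  \<open>K\<close> are replaced by isomorphic copies \<open>G0\<close> and \<open>K0\<close>.
\<close>

lemma in_class_if_residual_subset_kernel: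
  assumes F: "formation F" and G: "group G" and fin: "finite (carrier G)"
    and K: "group K" and g: "g \<in> epi G K" and ker: "residual F G \<subseteq> kernel G K g"
  shows "in_class K F"
proof -
  interpret G: group G by fact
  obtain G0 :: "nat monoid" and h where G0: "group G0" "finite (carrier G0)" and h: "h \<in> iso G G0"
    using finite_group_nat_copy[OF G fin] unfolding is_iso_def by blast
  obtain h' where h': "h' \<in> epi G0 G"
    using G.iso_set_sym[OF h] unfolding iso_iff_mon_epi by blast
  have "finite (carrier K)" using g finite_imageI[OF fin, of g] by (simp add: epi_def)
  then obtain K0 :: "nat monoid" and k where K0: "group K0" and k: "k \<in> iso K K0"
    using finite_group_nat_copy[OF K] unfolding is_iso_def by blast
  let ?R = "residual F G0"
  have R: "?R \<lhd> G0" using normal_residual[OF G0(1)] .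
  have epi: "k \<circ> (g \<circ> h') \<in> epi G0 K0"
    using epi_compose[OF epi_compose[OF h' g]] k unfolding iso_iff_mon_epi by blast
  have k1: "k \<one>\<^bsub>K\<^esub> = \<one>\<^bsub>K0\<^esub>"
    using hom_one[OF iso_imp_homomorphism[OF k] K K0] .
  have "?R \<subseteq> kernel G0 K0 (k \<circ> (g \<circ> h'))"
  proof
    fix x assume x: "x \<in> ?R"
    then have "h' x \<in> kernel G K g" using residual_epi[OF G0(1) G h'] ker by blast
    moreover have "x \<in> carrier G0" using x by (simp add: residual_def)
    ultimately show "x \<in> kernel G0 K0 (k \<circ> (g \<circ> h'))" using k1 by (simp add: kernel_def)
  qed
  then have "epi (G0 Mod ?R) K0 \<noteq> {}"
    using epi_factor[OF G0(1) normal.factorgroup_is_group[OF R] K0 kernel_r_coset(1)[OF R] epi]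
    by (simp add: kernel_r_coset(2)[OF R])
  moreover have "\<forall>G :: nat monoid. group G \<and> finite (carrier G) \<longrightarrow>
        (\<forall>H :: nat monoid. group H \<and> epi (G Mod residual F G) H \<noteq> {} \<longrightarrow> H \<in> F)"
    using F unfolding formation_def by blast
  ultimately have "K0 \<in> F" using G0 K0 by simp
  moreover have "K \<cong> K0" using k by (auto simp only: is_iso_def)
  ultimately show ?thesis using K by (auto simp only: in_class_def)
qed

lemma in_class_FactGroup_if_residual_subset:
  assumes F: "formation F" and G: "group G" and fin: "finite (carrier G)"
    and N: "N \<lhd> G" and res: "residual F G \<subseteq> N"
  shows "in_class (G Mod N) F"
  using in_class_if_residual_subset_kernel[OF F G fin normal.factorgroup_is_group[OF N] kernel_r_coset(1)[OF N]] res
  unfolding kernel_r_coset(2)[OF N] .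

lemma in_class_epimorphic_image:
  assumes F: "formation F" and G: "in_class G F" and fin: "finite (carrier G)"
    and H: "group H" and f: "f \<in> epi G H"
  shows "in_class H F"
proof -
  have Gg: "group G" using G by (simp add: in_class_def)
  interpret f: group_hom G H f
    using Gg H f by (auto simp: group_hom_def group_hom_axioms_def epi_def)
  have "id \<in> epi G G" by (simp add: epi_def hom_def)
  then have "residual F G \<subseteq> kernel G G id" by (rule residual_subset_kernel[OF Gg _ G])
  also have "\<dots> \<subseteq> kernel G H f" by (auto simp: kernel_def)
  finally show ?thesis by (rule in_class_if_residual_subset_kernel[OF F Gg fin H f])
qed

section \<open>Saturation and supplements in the class\<close>

text \<open>
  Saturation is also transported from a copy \<open>G0\<close> on the natural numbers: an isomorphism carries
  residual to residual and maximal subgroups to maximal subgroups.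
\<close>

lemma in_class_if_residual_subset_frattini:
  assumes F: "saturated_formation F" and G: "group G" and fin: "finite (carrier G)"
    and sub: "residual F G \<subseteq> frattini G"
  shows "in_class G F"
proof -
  interpret G: group G by fact
  obtain G0 :: "nat monoid" and h where G0: "group G0" "finite (carrier G0)" and h: "h \<in> iso G G0"
    using finite_group_nat_copy[OF G fin] unfolding is_iso_def by blast
  interpret h: group_hom G G0 h
    using G G0 h by (auto simp: group_hom_def group_hom_axioms_def iso_def)
  define h' where "h' = inv_into (carrier G) h"
  have h'iso: "h' \<in> iso G0 G" unfolding h'_def using G.iso_set_sym[OF h] .
  interpret h': group_hom G0 G h'
    using G G0 h'iso by (auto simp: group_hom_def group_hom_axioms_def iso_def)
  have hh': "h (h' x) = x" if "x \<in> carrier G0" for x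
    using that h by (auto simp: h'_def iso_def bij_betw_def f_inv_into_f)
  have h'h: "h' (h x) = x" if "x \<in> carrier G" for x
    using that h by (auto simp: h'_def iso_def bij_betw_def inv_into_f_f)
  have "residual F G0 \<subseteq> frattini G0"
  proof
    fix x assume x: "x \<in> residual F G0"
    then have xc: "x \<in> carrier G0" by (simp add: residual_def)
    have h'x: "h' x \<in> frattini G"
      using residual_epi[OF G0(1) G _ x] h'iso sub by (auto simp: iso_iff_mon_epi)
    have "x \<in> M" if M: "maximal_subgroup M G0" for M
    proof -
      have Msub: "subgroup M G0" and Mne: "M \<noteq> carrier G0"
        using M by (auto simp: maximal_subgroup_def)
      have Mc: "M \<subseteq> carrier G0" using Msub by (rule subgroup.subset)
      have "maximal_subgroup (h' ` M) G"
        unfolding maximal_subgroup_def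
      proof (intro conjI allI impI)
        show "subgroup (h' ` M) G" using h'.subgroup_img_is_subgroup[OF Msub] .
        show "h' ` M \<noteq> carrier G"
        proof
          assume *: "h' ` M = carrier G"
          have "y \<in> M" if "y \<in> carrier G0" for y
          proof -
            have "h' y \<in> h' ` M" using * that by simp
            then show ?thesis using hh' that Mc by (metis imageE subsetD)
          qed
          then show False using Mne Mc by blast
        qed
        fix H assume H: "subgroup H G \<and> h' ` M \<subseteq> H"
        have Hc: "H \<subseteq> carrier G" using H subgroup.subset by blast
        have "subgroup (h ` H) G0" using h.subgroup_img_is_subgroup H by blast
        moreover have "M \<subseteq> h ` H"
        proof
          fix y assume y: "y \<in> M"
          then have "h' y \<in> H" "y = h (h' y)" using H hh' Mc by auto
          then show "y \<in> h ` H" by (rule image_eqI[rotated])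
        qed
        ultimately have hH: "h ` H = M \<or> h ` H = carrier G0"
          using M by (auto simp: maximal_subgroup_def)
        have h'hH: "h' ` h ` H = H"
        proof -
          have "h' (h x) = x" if "x \<in> H" for x using that h'h Hc by blast
          then show ?thesis by (simp add: image_image)
        qed
        have "h' ` carrier G0 = carrier G" using h'iso by (simp add: iso_def bij_betw_def)
        then show "H = h' ` M \<or> H = carrier G" using hH h'hH by auto
      qed
      then have "h' x \<in> h' ` M" using h'x by (auto simp: frattini_def)
      then show ?thesis using hh' xc Mc by (metis imageE subsetD)
    qed
    then show "x \<in> frattini G0" using xc by (auto simp: frattini_def)
  qed
  then have "G0 \<in> F" using F G0 unfolding saturated_formation_def by blast
  then show ?thesis using h G unfolding in_class_def is_iso_def by blast
qed

text \<open>The second isomorphism theorem, as an epimorphism from a supplement onto the quotient.\<close>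

lemma r_coset_epi_supplement:
  fixes G (structure)
  assumes N: "N \<lhd> G" and Y: "subgroup Y G" and NY: "N <#> Y = carrier G"
  shows "(\<lambda>x. N #> x) \<in> epi (G\<lparr>carrier := Y\<rparr>) (G Mod N)"
proof -
  interpret normal N G by fact
  have Yc: "Y \<subseteq> carrier G" using Y by (rule subgroup.subset)
  have "(\<lambda>x. N #> x) \<in> hom (G\<lparr>carrier := Y\<rparr>) (G Mod N)"
  proof (rule homI)
    fix x y assume xy: "x \<in> carrier (G\<lparr>carrier := Y\<rparr>)" "y \<in> carrier (G\<lparr>carrier := Y\<rparr>)"
    then have "x \<in> carrier G" "y \<in> carrier G" using Yc by auto
    then show "N #> x \<in> carrier (G Mod N)" "N #> (x \<otimes>\<^bsub>G\<lparr>carrier := Y\<rparr>\<^esub> y) = (N #> x) \<otimes>\<^bsub>G Mod N\<^esub> (N #> y)"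
      by (simp_all add: carrier_FactGroup rcos_sum)
  qed
  moreover have "carrier (G Mod N) \<subseteq> (\<lambda>x. N #> x) ` Y"
  proof
    fix A assume "A \<in> carrier (G Mod N)"
    then obtain g where g: "g \<in> carrier G" "A = N #> g" by (auto simp: carrier_FactGroup)
    then obtain n y where ny: "n \<in> N" "y \<in> Y" "g = n \<otimes> y"
      using NY[symmetric] by (auto simp: set_mult_def)
    have "N #> g = N #> y"
      using repr_independence[of g N y] ny Yc is_subgroup by (auto simp: r_coset_def)
    then show "A \<in> (\<lambda>x. N #> x) ` Y" using g ny by simp
  qed
  ultimately show ?thesis by (simp add: epi_iff_subset)
qed

lemma subset_set_mult:
  fixes G (structure)
  assumes "group G" and A: "subgroup A G" and B: "subgroup B G"
  shows "A \<subseteq> A <#> B" "B \<subseteq> A <#> B"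
proof -
  interpret group G by fact
  have "x = x \<otimes> \<one>" if "x \<in> A" for x using that A subgroup.mem_carrier by force
  then show "A \<subseteq> A <#> B" using subgroup.one_closed[OF B] unfolding set_mult_def by blast
  have "x = \<one> \<otimes> x" if "x \<in> B" for x using that B subgroup.mem_carrier by force
  then show "B \<subseteq> A <#> B" using subgroup.one_closed[OF A] unfolding set_mult_def by blast
qed

text \<open>
  A supplement \<open>Y\<close> of least order works.  A maximal subgroup \<open>M\<close> of \<open>Y\<close> that does not contain
  \<open>N \<inter> Y\<close> would satisfy \<open>(N \<inter> Y) M = Y\<close> and hence be a smaller supplement.  So \<open>N \<inter> Y\<close> lies in the
  Frattini subgroup of \<open>Y\<close>; it contains the residual of \<open>Y\<close> because \<open>Y/(N \<inter> Y)\<close> lies in \<open>F\<close>.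
\<close>

lemma supplement_in_class:
  assumes F: "saturated_formation F" and G: "group G" and fin: "finite (carrier G)"
    and N: "N \<lhd> G" and res: "residual F G \<subseteq> N"
  obtains Y where "subgroup Y G" "N <#>\<^bsub>G\<^esub> Y = carrier G" "in_class (G\<lparr>carrier := Y\<rparr>) F"
proof -
  interpret group G by fact
  interpret N: normal N G by fact
  have form: "formation F" using F by (simp add: saturated_formation_def)
  let ?P = "\<lambda>Y. subgroup Y G \<and> N <#>\<^bsub>G\<^esub> Y = carrier G"
  have "?P (carrier G)"
    using subgroup_self set_mult_carrier_idem[OF N.is_subgroup] commut_normal[OF subgroup_self N] by simp
  then obtain Y where Y: "?P Y" and min: "\<And>M. ?P M \<Longrightarrow> card Y \<le> card M"
    using ex_has_least_nat[of ?P "carrier G" card] by blast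
  have Ysub: "subgroup Y G" and NY: "N <#>\<^bsub>G\<^esub> Y = carrier G" using Y by auto
  have Yc: "Y \<subseteq> carrier G" using Ysub by (rule subgroup.subset)
  have finY: "finite Y" using finite_subset[OF Yc fin] .
  define GY where "GY = G\<lparr>carrier := Y\<rparr>"
  have GYg: "group GY" unfolding GY_def using subgroup_imp_group[OF Ysub] .
  have cGY: "carrier GY = Y" by (simp add: GY_def)
  have quo: "in_class (G Mod N) F"
    by (rule in_class_FactGroup_if_residual_subset[OF form G fin N res])
  have proj: "(\<lambda>x. N #>\<^bsub>G\<^esub> x) \<in> epi GY (G Mod N)"
    unfolding GY_def by (rule r_coset_epi_supplement[OF N Ysub NY])
  have "residual F GY \<subseteq> kernel GY (G Mod N) (\<lambda>x. N #>\<^bsub>G\<^esub> x)"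
    by (rule residual_subset_kernel[OF GYg proj quo])
  also have "\<dots> = N \<inter> Y"
    using Yc by (subst kernel_r_coset(2)[OF N, symmetric]) (auto simp: kernel_def cGY)
  also have "N \<inter> Y \<subseteq> frattini GY"
  proof -
    have "N \<inter> Y \<subseteq> M" if M: "maximal_subgroup M GY" for M
    proof (rule ccontr)
      assume nsub: "\<not> N \<inter> Y \<subseteq> M"
      have Msub: "subgroup M GY" and Mne: "M \<noteq> Y" using M by (auto simp: maximal_subgroup_def cGY)
      have MY: "M \<subseteq> Y" using subgroup.subset[OF Msub] by (simp add: cGY)
      have MG: "subgroup M G" using incl_subgroup[OF Ysub] Msub by (simp add: GY_def)
      have NYn: "N \<inter> Y \<lhd> GY" unfolding GY_def using normal_Int_subgroup[OF Ysub N] .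
      have "subgroup ((N \<inter> Y) <#>\<^bsub>GY\<^esub> M) GY"
        using group.mult_norm_subgroup[OF GYg NYn Msub] .
      moreover have "N \<inter> Y \<subseteq> (N \<inter> Y) <#>\<^bsub>GY\<^esub> M" "M \<subseteq> (N \<inter> Y) <#>\<^bsub>GY\<^esub> M"
        using subset_set_mult[OF GYg normal_imp_subgroup[OF NYn] Msub] by simp_all
      ultimately have full: "(N \<inter> Y) <#>\<^bsub>GY\<^esub> M = Y"
        using M nsub unfolding maximal_subgroup_def cGY by metis
      have "N <#>\<^bsub>G\<^esub> M = carrier G"
      proof -
        have Mc: "M \<subseteq> carrier G" using MY Yc by blast
        have "carrier G \<subseteq> N <#>\<^bsub>G\<^esub> M"
        proof
          fix g assume "g \<in> carrier G"
          then obtain n y where ny: "n \<in> N" "y \<in> Y" "g = n \<otimes>\<^bsub>G\<^esub> y"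
            using NY[symmetric] by (auto simp: set_mult_def)
          moreover have "y \<in> (N \<inter> Y) <#>\<^bsub>GY\<^esub> M" using ny(2) full by (simp only:)
          then obtain n' m where "n' \<in> N" "m \<in> M" "y = n' \<otimes>\<^bsub>G\<^esub> m"
            by (auto simp: set_mult_def GY_def)
          ultimately have "g = (n \<otimes>\<^bsub>G\<^esub> n') \<otimes>\<^bsub>G\<^esub> m" "n \<otimes>\<^bsub>G\<^esub> n' \<in> N" "m \<in> M"
            using Mc by (auto simp: m_assoc)
          then show "g \<in> N <#>\<^bsub>G\<^esub> M" by (auto simp: set_mult_def)
        qed
        then show ?thesis using setmult_subset_G[OF N.subset Mc] by blast
      qed
      then have "card Y \<le> card M" using min MG by blast
      moreover have "card M < card Y" using MY Mne finY by (simp add: psubset_card_mono psubsetI)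
      ultimately show False by simp
    qed
    then show ?thesis by (auto simp: frattini_def cGY)
  qed
  finally have "in_class GY F"
    using in_class_if_residual_subset_frattini[OF F GYg] finY by (simp add: cGY)
  then show thesis using that Ysub NY by (simp add: GY_def)
qed

section \<open>Central normal subgroups from supplements\<close>

lemma set_centraliserD:
  assumes "g \<in> set_centraliser G A"
  shows "g \<in> carrier G" "a \<in> A \<Longrightarrow> g \<otimes>\<^bsub>G\<^esub> a = a \<otimes>\<^bsub>G\<^esub> g"
  using assms unfolding set_centraliser_def by blast+

lemma normal_set_centraliser:
  fixes G (structure)
  assumes N: "N \<lhd> G"
  shows "set_centraliser G N \<lhd> G"
proof -
  interpret normal N G by fact
  have sub: "subgroup (set_centraliser G N) G"
  proof (rule subgroupI)
    show "set_centraliser G N \<noteq> {}"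
      using subset by (auto simp: set_centraliser_def intro!: exI[of _ \<one>])
    fix a assume a: "a \<in> set_centraliser G N"
    have "inv a \<otimes> n = n \<otimes> inv a" if "n \<in> N" for n
    proof -
      have ac: "a \<in> carrier G" and nc: "n \<in> carrier G" and e: "a \<otimes> n = n \<otimes> a"
        using a that subset by (auto simp: set_centraliser_def)
      have "inv a \<otimes> n = inv a \<otimes> (n \<otimes> a) \<otimes> inv a" using ac nc by (simp add: m_assoc)
      also have "\<dots> = n \<otimes> inv a" using ac nc by (simp flip: e m_assoc)
      finally show ?thesis .
    qed
    then show "inv a \<in> set_centraliser G N" using a by (auto simp: set_centraliser_def)
    fix b assume b: "b \<in> set_centraliser G N"
    have "a \<otimes> b \<otimes> n = n \<otimes> (a \<otimes> b)" if "n \<in> N" for n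
    proof -
      have c: "a \<in> carrier G" "b \<in> carrier G" "n \<in> carrier G"
        and e: "a \<otimes> n = n \<otimes> a" "b \<otimes> n = n \<otimes> b"
        using a b that subset by (auto simp: set_centraliser_def)
      show ?thesis using c e by (metis m_assoc)
    qed
    then show "a \<otimes> b \<in> set_centraliser G N" using a b by (auto simp: set_centraliser_def)
  qed (auto simp: set_centraliser_def)
  show ?thesis
  proof (rule normal_invI[OF sub])
    fix x h assume x: "x \<in> carrier G" and h: "h \<in> set_centraliser G N"
    have hc: "h \<in> carrier G" using h by (simp add: set_centraliser_def)
    have "x \<otimes> h \<otimes> inv x \<otimes> n = n \<otimes> (x \<otimes> h \<otimes> inv x)" if n: "n \<in> N" for n
    proof -
      have nc: "n \<in> carrier G" using n subset by auto
      have "h \<otimes> (inv x \<otimes> n \<otimes> x) = (inv x \<otimes> n \<otimes> x) \<otimes> h"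
        using h inv_op_closed1[OF x n] by (simp add: set_centraliser_def)
      then have "x \<otimes> (h \<otimes> (inv x \<otimes> n \<otimes> x)) \<otimes> inv x = x \<otimes> ((inv x \<otimes> n \<otimes> x) \<otimes> h) \<otimes> inv x"
        by simp
      moreover have "x \<otimes> (h \<otimes> (inv x \<otimes> n \<otimes> x)) \<otimes> inv x = x \<otimes> h \<otimes> inv x \<otimes> n"
        using x hc nc by (simp add: m_assoc)
      moreover have "x \<otimes> ((inv x \<otimes> n \<otimes> x) \<otimes> h) \<otimes> inv x = (x \<otimes> inv x) \<otimes> n \<otimes> (x \<otimes> h \<otimes> inv x)"
        using x hc nc by (simp only: m_assoc inv_closed m_closed)
      ultimately show ?thesis using x hc nc by simp
    qed
    then show "x \<otimes> h \<otimes> inv x \<in> set_centraliser G N"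
      using x hc by (auto simp: set_centraliser_def)
  qed
qed

text \<open>
  The semidirect product \<open>[R]Y\<close> is represented by the subgroup \<open>S\<close> of all pairs \<open>(y, z)\<close> in \<open>Y \<times> Y\<close>
  with \<open>y\<^sup>-\<^sup>1 z \<in> R\<close>; the pair corresponds to the element \<open>(y\<^sup>-\<^sup>1 z, y)\<close> of the semidirect product.  The two
  projections of \<open>S\<close> map onto \<open>Y\<close>, which lies in \<open>F\<close>, and they have only the identity in common in their
  kernels.  So the residual of \<open>S\<close> is trivial and every image of \<open>S\<close> lies in \<open>F\<close>.
  One such image is \<open>[R](G/K)\<close> for \<open>K\<close> the centraliser of \<open>R\<close>, because \<open>G = K Y\<close>.
\<close>

lemma central_normal_subgroup_if_in_supplement:
  fixes G (structure)
  assumes F: "formation F" and G: "group G" and fin: "finite (carrier G)" and R: "R \<lhd> G"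
    and Y: "subgroup Y G" and YF: "in_class (G\<lparr>carrier := Y\<rparr>) F" and RY: "R \<subseteq> Y"
    and cov: "set_centraliser G R <#> Y = carrier G"
  shows "central_normal_subgroup F G R"
proof -
  interpret R: normal R G by fact
  define K where "K = set_centraliser G R"
  have K: "K \<lhd> G" unfolding K_def by (rule normal_set_centraliser[OF R])
  interpret K: normal K G by fact
  have Yc: "y \<in> carrier G" if "y \<in> Y" for y using that subgroup.subset[OF Y] by blast
  have Rc: "r \<in> carrier G" if "r \<in> R" for r using that R.subset by blast
  have sec: "normal_section R {\<one>} G"
    using R R.one_is_normal by (simp add: normal_section_def)
  have lco: "a <# {\<one>} = {a}" if "a \<in> carrier G" for a
    using that by (simp add: l_coset_def)
  have Ksub: "K \<subseteq> section_centraliser G R {\<one>}"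
  proof
    fix k assume k: "k \<in> K"
    have kc: "k \<in> carrier G" using k unfolding K_def by (rule set_centraliserD)
    have "inv k \<otimes> r \<otimes> k = r" if r: "r \<in> R" for r
    proof -
      have "inv k \<otimes> (k \<otimes> r) = r" using kc Rc[OF r] by (simp flip: R.m_assoc)
      moreover have "k \<otimes> r = r \<otimes> k" using k r unfolding K_def by (rule set_centraliserD)
      ultimately show ?thesis using kc Rc[OF r] by (simp add: R.m_assoc)
    qed
    then show "k \<in> section_centraliser G R {\<one>}"
      using kc by (simp add: section_centraliser_def)
  qed
  define S where "S = {(y, z). y \<in> Y \<and> z \<in> Y \<and> inv y \<otimes> z \<in> R}"
  define P where "P = (G \<times>\<times> G)\<lparr>carrier := S\<rparr>"
  have SI: "(y, z) \<in> S" if "y \<in> Y" "z \<in> Y" "inv y \<otimes> z \<in> R" for y z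
    using that by (simp add: S_def)
  \<comment> \<open>This identity shows that \<open>S\<close> is closed and that the map \<open>\<phi>\<close> below is multiplicative.\<close>
  have mulcalc: "inv (y \<otimes> y') \<otimes> (z \<otimes> z') = inv y' \<otimes> (inv y \<otimes> z) \<otimes> y' \<otimes> (inv y' \<otimes> z')"
    if c: "y \<in> carrier G" "z \<in> carrier G" "y' \<in> carrier G" "z' \<in> carrier G" for y z y' z'
  proof -
    have "y' \<otimes> (inv y' \<otimes> z') = z'" using c by (simp flip: R.m_assoc)
    then show ?thesis using c by (simp add: R.inv_mult_group R.m_assoc)
  qed
  have "subgroup S (G \<times>\<times> G)"
  proof (rule group.subgroupI[OF DirProd_group[OF G G]])
    show "S \<subseteq> carrier (G \<times>\<times> G)" using Yc by (auto simp: S_def)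
    have "(\<one>, \<one>) \<in> S" by (rule SI) (use subgroup.one_closed[OF Y] in auto)
    then show "S \<noteq> {}" by blast
    fix a assume "a \<in> S"
    then obtain y z where a: "a = (y, z)" "y \<in> Y" "z \<in> Y" "inv y \<otimes> z \<in> R" by (auto simp: S_def)
    have c: "y \<in> carrier G" "z \<in> carrier G" using a Yc by auto
    have "y \<otimes> inv (inv y \<otimes> z) \<otimes> inv y \<in> R" using a(4) c by (simp only: R.inv_op_closed2 R.m_inv_closed)
    moreover have "y \<otimes> inv (inv y \<otimes> z) \<otimes> inv y = inv (inv y) \<otimes> inv z"
      using c by (simp add: R.inv_mult_group R.m_assoc)
    ultimately have "(inv y, inv z) \<in> S" using a Y by (intro SI) (simp_all add: subgroup.m_inv_closed)
    then show "inv\<^bsub>G \<times>\<times> G\<^esub> a \<in> S" using a c G by simp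
    fix b assume "b \<in> S"
    then obtain y' z' where b: "b = (y', z')" "y' \<in> Y" "z' \<in> Y" "inv y' \<otimes> z' \<in> R" by (auto simp: S_def)
    have c': "y' \<in> carrier G" "z' \<in> carrier G" using b Yc by auto
    have "inv (y \<otimes> y') \<otimes> (z \<otimes> z') \<in> R"
      unfolding mulcalc[OF c c']
      by (rule subgroup.m_closed[OF R.is_subgroup R.inv_op_closed1[OF c'(1) a(4)] b(4)])
    then have "(y \<otimes> y', z \<otimes> z') \<in> S" using a b Y by (intro SI) (simp_all add: subgroup.m_closed)
    then show "a \<otimes>\<^bsub>G \<times>\<times> G\<^esub> b \<in> S" using a b by simp
  qed
  then have P: "group P" unfolding P_def
    by (rule group.subgroup_imp_group[OF DirProd_group[OF G G]])
  have finP: "finite (carrier P)"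
  proof (rule finite_subset)
    show "carrier P \<subseteq> carrier G \<times> carrier G" using Yc by (auto simp: P_def S_def)
  qed (use fin in simp)
  have diag: "(y, y) \<in> S" if "y \<in> Y" for y
    using that Yc by (intro SI) auto
  have "fst \<in> hom P (G\<lparr>carrier := Y\<rparr>)" "snd \<in> hom P (G\<lparr>carrier := Y\<rparr>)"
    by (auto simp: hom_def P_def S_def)
  moreover have "Y \<subseteq> fst ` S" "Y \<subseteq> snd ` S"
    using diag by force+
  ultimately have "fst \<in> epi P (G\<lparr>carrier := Y\<rparr>)" "snd \<in> epi P (G\<lparr>carrier := Y\<rparr>)"
    by (simp_all add: epi_iff_subset P_def)
  then have "residual F P \<subseteq> kernel P (G\<lparr>carrier := Y\<rparr>) fst \<inter> kernel P (G\<lparr>carrier := Y\<rparr>) snd"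
    using residual_subset_kernel[OF P _ YF] by blast
  then have res: "residual F P \<subseteq> {(\<one>, \<one>)}"
    by (auto simp: kernel_def)
  let ?E = "section_semidirect G R {\<one>} K"
  define \<phi> where "\<phi> = (\<lambda>(y, z). ({inv y \<otimes> z}, K #> y))"
  have carN: "carrier (section_group G R {\<one>}) = (\<lambda>r. {r}) ` R"
    using Rc by (auto simp: section_group_def carrier_FactGroup r_coset_def)
  have conj: "coset_conj G {r} (K #> g) = {inv g \<otimes> r \<otimes> g}" if "r \<in> R" "g \<in> carrier G" for r g
  proof -
    have "K #> g = g <# K" using K.coset_eq that(2) by blast
    then show ?thesis using coset_conj_eq[OF sec K Ksub that] that Rc by (simp add: lco)
  qed
  have "\<phi> \<in> hom P ?E"
  proof (rule homI)
    fix a assume "a \<in> carrier P"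
    then obtain y z where a: "a = (y, z)" "y \<in> Y" "z \<in> Y" "inv y \<otimes> z \<in> R" by (auto simp: S_def P_def)
    have c: "y \<in> carrier G" "z \<in> carrier G" using a Yc by auto
    show "\<phi> a \<in> carrier ?E"
      using a c by (simp add: \<phi>_def section_semidirect_def semidirect_def carN carrier_FactGroup)
    fix b assume "b \<in> carrier P"
    then obtain y' z' where b: "b = (y', z')" "y' \<in> Y" "z' \<in> Y" "inv y' \<otimes> z' \<in> R" by (auto simp: S_def P_def)
    have c': "y' \<in> carrier G" "z' \<in> carrier G" using b Yc by auto
    show "\<phi> (a \<otimes>\<^bsub>P\<^esub> b) = \<phi> a \<otimes>\<^bsub>?E\<^esub> \<phi> b"
      using a(4) c c' mulcalc[OF c c']
      by (simp add: a(1) b(1) \<phi>_def P_def section_semidirect_def semidirect_def section_group_def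
          conj set_mult_def[of G "{_}"] K.rcos_sum)
  qed
  moreover have "carrier ?E \<subseteq> \<phi> ` carrier P"
  proof
    fix e assume "e \<in> carrier ?E"
    then obtain r g where e: "e = ({r}, K #> g)" "r \<in> R" "g \<in> carrier G"
      by (auto simp: section_semidirect_def semidirect_def carN carrier_FactGroup)
    have "K #> g \<in> (\<lambda>y. K #> y) ` Y"
      using r_coset_epi_supplement[OF K Y] cov e(3) by (auto simp: epi_def K_def carrier_FactGroup)
    then obtain y where y: "y \<in> Y" "K #> g = K #> y" by blast
    have c: "r \<in> carrier G" "y \<in> carrier G" using Rc Yc e y by auto
    have inv: "inv y \<otimes> (y \<otimes> r) = r" using c by (simp flip: R.m_assoc)
    have "(y, y \<otimes> r) \<in> S"
      using y e RY Y inv by (intro SI) (auto simp: subgroup.m_closed)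
    moreover have "e = \<phi> (y, y \<otimes> r)" using e y inv by (simp add: \<phi>_def)
    ultimately show "e \<in> \<phi> ` carrier P" by (auto simp: P_def)
  qed
  ultimately have \<phi>: "\<phi> \<in> epi P ?E" by (simp add: epi_iff_subset)
  have "\<phi> (\<one>, \<one>) = \<one>\<^bsub>?E\<^esub>"
    using K.subset by (simp add: \<phi>_def section_semidirect_def semidirect_def section_group_def)
  then have "residual F P \<subseteq> kernel P ?E \<phi>"
    using res by (auto simp: kernel_def residual_def)
  then have "in_class ?E F"
    using in_class_if_residual_subset_kernel[OF F P finP section_semidirect_group[OF sec K Ksub] \<phi>] by blast
  then show ?thesis
    using R sec K Ksub by (auto simp: central_normal_subgroup_def central_section_def)
qed

section \<open>The centraliser of the residual\<close>

theorem theorem2: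
  fixes F :: "nat monoid set" and G :: "('a, 'b) monoid_scheme"
  assumes "saturated_formation F"
    and "group G" and "finite (carrier G)"
    and "\<And>R. central_normal_subgroup F G R \<Longrightarrow> R = {\<one>\<^bsub>G\<^esub>}"
  shows "set_centraliser G (residual F G) \<subseteq> residual F G"
proof -
  note F = assms(1) and G = assms(2) and fin = assms(3)
  interpret group G by fact
  have form: "formation F" using F by (simp add: saturated_formation_def)
  define D where "D = residual F G"
  define C where "C = set_centraliser G D"
  have D: "D \<lhd> G" unfolding D_def by (rule normal_residual[OF G])
  have C: "C \<lhd> G" unfolding C_def by (rule normal_set_centraliser[OF D])
  interpret D: normal D G by fact
  interpret C: normal C G by fact
  have comm: "c \<otimes>\<^bsub>G\<^esub> d = d \<otimes>\<^bsub>G\<^esub> c" if "c \<in> C" "d \<in> D" for c d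
    using that unfolding C_def by (rule set_centraliserD)
  have D_acts_trivially: "d \<otimes>\<^bsub>G\<^esub> c \<otimes>\<^bsub>G\<^esub> inv\<^bsub>G\<^esub> d = c" if "c \<in> C" "d \<in> D" for c d
  proof -
    have "d \<otimes>\<^bsub>G\<^esub> c \<otimes>\<^bsub>G\<^esub> inv\<^bsub>G\<^esub> d = c \<otimes>\<^bsub>G\<^esub> d \<otimes>\<^bsub>G\<^esub> inv\<^bsub>G\<^esub> d" by (simp only: comm[OF that])
    also have "\<dots> = c" using that C.subset D.subset by (auto simp: m_assoc)
    finally show ?thesis .
  qed
  have GD: "in_class (G Mod D) F"
    by (rule in_class_FactGroup_if_residual_subset[OF form G fin D]) (simp add: D_def)

  \<comment> \<open>Passing from \<open>G\<close> to \<open>H = C L\<close> makes the quotient by \<open>C\<close> lie in the class; \<open>G/C\<close> need not.\<close>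
  obtain L where L: "subgroup L G" and DL: "D <#>\<^bsub>G\<^esub> L = carrier G" and LF: "in_class (G\<lparr>carrier := L\<rparr>) F"
    using supplement_in_class[OF F G fin D] by (auto simp: D_def)
  have Lc: "L \<subseteq> carrier G" using L by (rule subgroup.subset)
  define H where "H = C <#>\<^bsub>G\<^esub> L"
  define GH where "GH = G\<lparr>carrier := H\<rparr>"
  have H: "subgroup H G" unfolding H_def by (rule mult_norm_subgroup[OF C L])
  have Hc: "H \<subseteq> carrier G" using H by (rule subgroup.subset)
  have GHg: "group GH" unfolding GH_def by (rule subgroup_imp_group[OF H])
  have finH: "finite (carrier GH)" using finite_subset[OF Hc fin] by (simp add: GH_def)
  have CH: "C \<subseteq> H" and LH: "L \<subseteq> H"
    unfolding H_def using subset_set_mult[OF G C.is_subgroup L] by simp_all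

  have DH: "D <#>\<^bsub>G\<^esub> H = carrier G"
    using mono_set_mult[OF order_refl LH, of G D] DL setmult_subset_G[OF D.subset Hc] by simp
  have resD: "residual F GH \<subseteq> D"
  proof -
    have "residual F GH \<subseteq> kernel GH (G Mod D) (\<lambda>x. D #>\<^bsub>G\<^esub> x)"
      using r_coset_epi_supplement[OF D H DH] residual_subset_kernel[OF GHg _ GD] by (simp add: GH_def)
    also have "\<dots> \<subseteq> kernel G (G Mod D) (\<lambda>x. D #>\<^bsub>G\<^esub> x)"
      using Hc by (auto simp: kernel_def GH_def)
    finally show ?thesis by (simp add: kernel_r_coset(2)[OF D])
  qed
  have CGH: "C \<lhd> GH"
    using normal_Int_subgroup[OF H C] CH by (simp add: GH_def Int_absorb2)
  have resC: "residual F GH \<subseteq> C"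
  proof -
    have "subgroup L GH" unfolding GH_def by (rule subgroup_incl[OF L H LH])
    moreover have "C <#>\<^bsub>GH\<^esub> L = carrier GH" by (simp add: GH_def H_def)
    ultimately have epi: "(\<lambda>x. C #>\<^bsub>GH\<^esub> x) \<in> epi (GH\<lparr>carrier := L\<rparr>) (GH Mod C)"
      by (rule r_coset_epi_supplement[OF CGH])
    have GHL: "GH\<lparr>carrier := L\<rparr> = G\<lparr>carrier := L\<rparr>" by (simp add: GH_def)
    have "in_class (GH Mod C) F"
      using in_class_epimorphic_image[OF form LF _ normal.factorgroup_is_group[OF CGH]]
        epi finite_subset[OF Lc fin] by (simp add: GHL)
    then show ?thesis
      using residual_subset_kernel[OF GHg kernel_r_coset(1)[OF CGH]] by (simp add: kernel_r_coset(2)[OF CGH])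
  qed

  \<comment> \<open>The residual of \<open>H\<close> now lies in \<open>Z = C \<inter> D\<close>, so \<open>Z\<close> has a supplement in the class.\<close>
  have Z: "C \<inter> D \<lhd> GH"
    using normal_Int_subgroup[OF H normal_subgroup_intersect[OF C D]] CH
    by (simp add: GH_def Int_absorb2 le_infI1)
  obtain Y where Y': "subgroup Y GH" and ZY: "(C \<inter> D) <#>\<^bsub>GH\<^esub> Y = carrier GH"
    and YF': "in_class (GH\<lparr>carrier := Y\<rparr>) F"
    using supplement_in_class[OF F GHg finH Z] resC resD by blast
  have Y: "subgroup Y G" using incl_subgroup[OF H] Y' by (simp add: GH_def)
  have YF: "in_class (G\<lparr>carrier := Y\<rparr>) F" using YF' by (simp add: GH_def)
  have Yc: "Y \<subseteq> carrier G" using Y by (rule subgroup.subset)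
  have Hdec: "\<exists>z\<in>C \<inter> D. \<exists>y\<in>Y. h = z \<otimes>\<^bsub>G\<^esub> y" if "h \<in> H" for h
  proof -
    have "h \<in> (C \<inter> D) <#>\<^bsub>GH\<^esub> Y" unfolding ZY using that by (simp add: GH_def)
    then show ?thesis by (auto simp: GH_def set_mult_def)
  qed
  have Gdec: "\<exists>d\<in>D. \<exists>y\<in>Y. g = d \<otimes>\<^bsub>G\<^esub> y" if g: "g \<in> carrier G" for g
  proof -
    obtain d h where dh: "d \<in> D" "h \<in> H" "g = d \<otimes>\<^bsub>G\<^esub> h"
      using g DH[symmetric] by (auto simp: set_mult_def)
    then obtain z y where zy: "z \<in> D" "y \<in> Y" "h = z \<otimes>\<^bsub>G\<^esub> y" using Hdec by blast
    have "g = (d \<otimes>\<^bsub>G\<^esub> z) \<otimes>\<^bsub>G\<^esub> y"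
      using dh zy D.subset Yc by (auto simp: m_assoc)
    then show ?thesis using subgroup.m_closed[OF D.is_subgroup dh(1) zy(1)] zy(2) by blast
  qed
  define R where "R = Y \<inter> C"
  have R: "R \<lhd> G"
  proof (rule normal_invI)
    show "subgroup R G" unfolding R_def by (rule subgroups_Inter_pair[OF Y C.is_subgroup])
    fix x r assume x: "x \<in> carrier G" and r: "r \<in> R"
    obtain d y where dy: "d \<in> D" "y \<in> Y" "x = d \<otimes>\<^bsub>G\<^esub> y" using Gdec[OF x] by blast
    have c: "d \<in> carrier G" "y \<in> carrier G" "r \<in> carrier G"
      using dy r Yc D.subset C.subset by (auto simp: R_def)
    let ?s = "y \<otimes>\<^bsub>G\<^esub> r \<otimes>\<^bsub>G\<^esub> inv\<^bsub>G\<^esub> y"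
    have sY: "?s \<in> Y" using dy r Y by (simp add: R_def subgroup.m_closed subgroup.m_inv_closed)
    have sC: "?s \<in> C" using c r by (simp add: R_def C.inv_op_closed2)
    have "x \<otimes>\<^bsub>G\<^esub> r \<otimes>\<^bsub>G\<^esub> inv\<^bsub>G\<^esub> x = (d \<otimes>\<^bsub>G\<^esub> ?s) \<otimes>\<^bsub>G\<^esub> inv\<^bsub>G\<^esub> d"
      using c by (simp add: dy(3) inv_mult_group m_assoc)
    also have "\<dots> = ?s"
      using sC dy(1) by (rule D_acts_trivially)
    finally show "x \<otimes>\<^bsub>G\<^esub> r \<otimes>\<^bsub>G\<^esub> inv\<^bsub>G\<^esub> x \<in> R" using sY sC by (simp add: R_def)
  qed
  have "D \<subseteq> set_centraliser G R"
    unfolding set_centraliser_def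
  proof (intro subsetI CollectI conjI ballI)
    fix d r assume "d \<in> D" "r \<in> R"
    then show "d \<otimes>\<^bsub>G\<^esub> r = r \<otimes>\<^bsub>G\<^esub> d" using comm[of r d] by (simp add: R_def)
  qed (use D.subset in blast)
  then have "D <#>\<^bsub>G\<^esub> Y \<subseteq> set_centraliser G R <#>\<^bsub>G\<^esub> Y" by (intro mono_set_mult order_refl)
  moreover have "carrier G \<subseteq> D <#>\<^bsub>G\<^esub> Y" using Gdec unfolding set_mult_def by blast
  moreover have "set_centraliser G R <#>\<^bsub>G\<^esub> Y \<subseteq> carrier G"
    by (rule setmult_subset_G[OF normal_imp_subgroup[THEN subgroup.subset, OF normal_set_centraliser[OF R]] Yc])
  ultimately have "central_normal_subgroup F G R"
    using central_normal_subgroup_if_in_supplement[OF form G fin R Y YF] by (simp add: R_def)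
  then have R1: "R = {\<one>\<^bsub>G\<^esub>}" by (rule assms(4))
  \<comment> \<open>Dedekind: the \<open>Y\<close>-part of an element of \<open>C\<close> lies in \<open>R\<close>, which is trivial.\<close>
  have "c \<in> D" if c: "c \<in> C" for c
  proof -
    obtain z y where zy: "z \<in> C" "z \<in> D" "y \<in> Y" "c = z \<otimes>\<^bsub>G\<^esub> y" using Hdec c CH by blast
    have zc: "z \<in> carrier G" "y \<in> carrier G" using zy C.subset Yc by auto
    have "y = inv\<^bsub>G\<^esub> z \<otimes>\<^bsub>G\<^esub> c" using zc by (simp add: zy(4) flip: m_assoc)
    then have "y \<in> C" using zy(1) c by simp
    then have "y = \<one>\<^bsub>G\<^esub>" using R1 zy(3) by (auto simp: R_def)
    then show ?thesis using zy zc by simp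
  qed
  then show ?thesis unfolding C_def D_def by blast
qed

end
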